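(* Let $K^*\ge1$, let $\alpha^*_1,\dots,\alpha^*_{K^*}$ be distinct nonzero complex numbers, and let $\Phi_n,\Phi^*_n,\Xi_n,\Xi^*_n$ be the bi-orthogonal system of the weight $\widehat w(z)=\prod_{j=1}^{K^*}(1-\alpha^*_jz^{-1})\,w(z)$. For a sequence $a=(a_m)$ let $$v(a,z)=\big(a_n(z),z^{-1}a_{n+1}(z),\dots,z^{-K^*}a_{n+K^*}(z)\big),$$ and let $\det(v_0;\dots;v_N)$ be the determinant with rows $v_0,\dots,v_N$. Then for each $n\ge0$ there are constants $C,C^*$ independent of $z$ such that $$\prod_{j=1}^{K^*}(1-\alpha^*_jz^{-1})\,\Phi_n(z)=C\det\big(v(\phi,z);v(\phi,\alpha^*_1);\dots;v(\phi,\alpha^*_{K^*})\big),$$ $$\prod_{j=1}^{K^*}(1-\alpha^*_jz^{-1})\,\Phi^*_n(z)=C^*\det\big(v(\phi^*,z);v(\phi^*,\alpha^*_1);\dots;v(\phi^*,\alpha^*_{K^*})\big),$$ $$\Xi_n(z)=C\det\big(v(\xi,z);v(\phi,\alpha^*_1);\dots;v(\phi,\alpha^*_{K^*})\big),$$ $$\Xi^*_n(z)=C^*\det\big(v(\xi^*,z);v(\phi^*,\alpha^*_1);\dots;v(\phi^*,\alpha^*_{K^*})\big).$$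
   Context: $\mathbb T$ is the unit circle. For a complex-valued weight $w$ on $\mathbb T$ put $w_k=\int_{\mathbb T}\frac{d\zeta}{2\pi i\zeta}w(\zeta)\zeta^{-k}$ and $I_n[w]=\det[w_{j-k}]_{j,k=0,\dots,n-1}$, $I_0=1$. If $I_n[w]\ne0$ for all $n\ge0$, the bi-orthogonal system of $w$ is: polynomials $\phi_n,\bar\phi_n$ of degree $n$ with the same leading coefficient $\kappa_n$ satisfying $\int_{\mathbb T}\frac{d\zeta}{2\pi i\zeta}w(\zeta)\phi_m(\zeta)\bar\phi_n(\bar\zeta)=\delta_{m,n}$ with $\bar\zeta=1/\zeta$ ($\bar\phi_n$ is a separate polynomial, not in general the complex conjugate of $\phi_n$; $\kappa_n^2=I_n/I_{n+1}$, with a choice of square root $\kappa_n$ fixed); the reciprocal polynomial $\phi^*_n(z)=z^n\bar\phi_n(1/z)$; and the associated functions, for $z\notin\mathbb T$ and $n>0$, $\xi_n(z)=\int_{\mathbb T}\frac{d\zeta}{2\pi i\zeta}\frac{\zeta+z}{\zeta-z}w(\zeta)\phi_n(\zeta)$, $\ \xi^*_n(z)=-z^n\int_{\mathbb T}\frac{d\zeta}{2\pi i\zeta}\frac{\zeta+z}{\zeta-z}w(\zeta)\bar\phi_n(\bar\zeta)=\frac1{\kappa_n}-\int_{\mathbb T}\frac{d\zeta}{2\pi i\zeta}\frac{\zeta+z}{\zeta-z}w(\zeta)\phi^*_n(\zeta)$, and $\xi_0(z)=\kappa_0[w_0+F(z)]$, $\xi^*_0(z)=\kappa_0[w_0-F(z)]$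 with $F(z)=\int_{\mathbb T}\frac{d\zeta}{2\pi i\zeta}\frac{\zeta+z}{\zeta-z}w(\zeta)$. Set $r_n=\phi_n(0)/\kappa_n$, $\bar r_n=\bar\phi_n(0)/\kappa_n$. The same definitions and normalisation applied to a modified weight $\widehat w$ give $\Phi_n,\bar\Phi_n,\Phi^*_n,\Xi_n,\Xi^*_n$, leading coefficient $\widehat\kappa_n$, and $\widehat r_n,\widehat{\bar r}_n$. Standing generic assumptions: both the original and the modified bi-orthogonal systems exist, and $r_n\bar r_n\ne0,1$, $\widehat r_n\widehat{\bar r}_n\ne0,1$ for all $n\ge1$. *)

theory Defs
  imports
    "HOL-Complex_Analysis.Contour_Integration"
    "HOL-Computational_Algebra.Polynomial"
    "Jordan_Normal_Form.Determinant"
begin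

text \<open>Square matrices of variable size are those of \<^theory>\<open>Jordan_Normal_Form.Matrix\<close>. The names
  shared with HOL-Analysis are qualified.\<close>

definition circle_weight :: "(complex \<Rightarrow> complex) \<Rightarrow> bool" where
  "circle_weight w \<longleftrightarrow> (\<lambda>t. w (circlepath 0 1 t)) absolutely_integrable_on {0..1}"

definition circle_int :: "(complex \<Rightarrow> complex) \<Rightarrow> complex" where
  "circle_int f = contour_integral (circlepath 0 1) (\<lambda>\<zeta>. f \<zeta> / (2 * of_real pi * \<i> * \<zeta>))"

definition moment :: "(complex \<Rightarrow> complex) \<Rightarrow> int \<Rightarrow> complex" where
  "moment w k = circle_int (\<lambda>\<zeta>. w \<zeta> * \<zeta> powi (- k))"

definition toeplitz_det :: "(complex \<Rightarrow> complex) \<Rightarrow> nat \<Rightarrow> complex" where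
  "toeplitz_det w n =
     Determinant.det (Matrix.mat n n (\<lambda>(j, k). moment w (int j - int k)))"

text \<open>The second sequence \<open>\<phi>b\<close> is a separate sequence of polynomials, evaluated at \<open>1/\<zeta>\<close>. The
  normalisation leaves only the sign of each leading coefficient free, so the choice of the square
  root \<open>\<kappa>\<^sub>n\<close> of \<open>I\<^sub>n / I\<^sub>n\<^sub>+\<^sub>1\<close> is part of the data \<open>(\<phi>, \<phi>b)\<close>, with \<open>\<kappa>\<^sub>n = lead_coeff (\<phi> n)\<close>.\<close>

definition biorthogonal_system ::
    "(complex \<Rightarrow> complex) \<Rightarrow> (nat \<Rightarrow> complex poly) \<Rightarrow> (nat \<Rightarrow> complex poly) \<Rightarrow> bool" where
  "biorthogonal_system w \<phi> \<phi>b \<longleftrightarrow>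
     (\<forall>n. toeplitz_det w n \<noteq> 0) \<and>
     (\<forall>n. degree (\<phi> n) = n \<and> degree (\<phi>b n) = n \<and> lead_coeff (\<phi> n) = lead_coeff (\<phi>b n)) \<and>
     (\<forall>m n. circle_int (\<lambda>\<zeta>. w \<zeta> * poly (\<phi> m) \<zeta> * poly (\<phi>b n) (1 / \<zeta>)) = (if m = n then 1 else 0))"

text \<open>As \<open>\<phi>b n\<close> has degree \<open>n\<close>, its \<^const>\<open>reflect_poly\<close> is the polynomial \<open>z\<^sup>n \<phi>b\<^sub>n(1/z)\<close>.\<close>

definition reciprocal_seq :: "(nat \<Rightarrow> complex poly) \<Rightarrow> nat \<Rightarrow> complex poly" where
  "reciprocal_seq \<phi>b n = reflect_poly (\<phi>b n)"

definition carath :: "(complex \<Rightarrow> complex) \<Rightarrow> complex \<Rightarrow> complex" where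
  "carath w z = circle_int (\<lambda>\<zeta>. (\<zeta> + z) / (\<zeta> - z) * w \<zeta>)"

text \<open>The associated functions are meant for \<open>z\<close> off the unit circle.\<close>

definition assoc ::
    "(complex \<Rightarrow> complex) \<Rightarrow> (nat \<Rightarrow> complex poly) \<Rightarrow> nat \<Rightarrow> complex \<Rightarrow> complex" where
  "assoc w \<phi> n z =
     (if n = 0 then lead_coeff (\<phi> 0) * (moment w 0 + carath w z)
      else circle_int (\<lambda>\<zeta>. (\<zeta> + z) / (\<zeta> - z) * w \<zeta> * poly (\<phi> n) \<zeta>))"

definition assoc_star ::
    "(complex \<Rightarrow> complex) \<Rightarrow> (nat \<Rightarrow> complex poly) \<Rightarrow> nat \<Rightarrow> complex \<Rightarrow> complex" where
  "assoc_star w \<phi>b n z =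
     (if n = 0 then lead_coeff (\<phi>b 0) * (moment w 0 - carath w z)
      else - (z ^ n) * circle_int (\<lambda>\<zeta>. (\<zeta> + z) / (\<zeta> - z) * w \<zeta> * poly (\<phi>b n) (1 / \<zeta>)))"

definition refl_coeff :: "(nat \<Rightarrow> complex poly) \<Rightarrow> nat \<Rightarrow> complex" where
  "refl_coeff \<phi> n = poly (\<phi> n) 0 / lead_coeff (\<phi> n)"

definition generic_system :: "(nat \<Rightarrow> complex poly) \<Rightarrow> (nat \<Rightarrow> complex poly) \<Rightarrow> bool" where
  "generic_system \<phi> \<phi>b \<longleftrightarrow>
     (\<forall>n\<ge>1. refl_coeff \<phi> n * refl_coeff \<phi>b n \<noteq> 0 \<and> refl_coeff \<phi> n * refl_coeff \<phi>b n \<noteq> 1)"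

definition christoffel_factor :: "nat \<Rightarrow> (nat \<Rightarrow> complex) \<Rightarrow> complex \<Rightarrow> complex" where
  "christoffel_factor K \<alpha> z = (\<Prod>j=1..K. 1 - \<alpha> j * inverse z)"

definition modified_weight ::
    "nat \<Rightarrow> (nat \<Rightarrow> complex) \<Rightarrow> (complex \<Rightarrow> complex) \<Rightarrow> complex \<Rightarrow> complex" where
  "modified_weight K \<alpha> w z = christoffel_factor K \<alpha> z * w z"

definition vrow :: "nat \<Rightarrow> nat \<Rightarrow> (nat \<Rightarrow> complex \<Rightarrow> complex) \<Rightarrow> complex \<Rightarrow> complex Matrix.vec" where
  "vrow K n a z = Matrix.vec (K + 1) (\<lambda>j. inverse z ^ j * a (n + j) z)"

definition christoffel_det ::
    "nat \<Rightarrow> (nat \<Rightarrow> complex) \<Rightarrow> nat \<Rightarrow> (nat \<Rightarrow> complex \<Rightarrow> complex) \<Rightarrow>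
     (nat \<Rightarrow> complex \<Rightarrow> complex) \<Rightarrow> complex \<Rightarrow> complex" where
  "christoffel_det K \<alpha> n a b z =
     Determinant.det (mat_of_rows (K + 1)
       (vrow K n a z # map (\<lambda>i. vrow K n b (\<alpha> i)) [1..<K + 1]))"

end

theory Submission
  imports Defs
begin

text \<open>Let \<open>D\<close> be the Christoffel factor. The Laurent polynomials supported on \<open>z\<^sup>-\<^sup>K, \<dots>, z\<^sup>n\<close> that are
  orthogonal under \<open>w\<close> to \<open>1, \<dots>, z\<^sup>n\<^sup>-\<^sup>1\<close> have the basis \<open>z\<^sup>-\<^sup>j \<phi>\<^sub>n\<^sub>+\<^sub>j\<close>, \<open>j \<le> K\<close>, because one can eliminate the
  lowest coefficient repeatedly (\<open>\<phi>\<^sub>m(0) \<noteq> 0\<close>). Hence \<open>D \<Phi>\<^sub>n = \<Sum>\<^sub>j c\<^sub>j z\<^sup>-\<^sup>j \<phi>\<^sub>n\<^sub>+\<^sub>j\<close>. A member of this space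
  that vanishes at all the \<open>\<alpha>\<^sub>i\<close> is divisible by \<open>D\<close>, and the quotient is a multiple of \<open>\<Phi>\<^sub>n\<close>, so \<open>c\<close> spans the
  kernel of the matrix with rows \<open>v(\<phi>, \<alpha>\<^sub>i)\<close>. By Cramer's rule, \<open>x \<bullet> c\<close> is then a constant multiple of the
  determinant with first row \<open>x\<close> for every \<open>x\<close>. Finally, \<open>\<xi>\<^sub>n(z)\<close> is twice the Cauchy integral of
  \<open>\<zeta> w \<phi>\<^sub>n\<close>, and by orthogonality this integral turns the factor \<open>\<zeta>\<^sup>-\<^sup>j\<close> in front of \<open>\<phi>\<^sub>n\<^sub>+\<^sub>j\<close> into \<open>z\<^sup>-\<^sup>j\<close>, so the
  same \<open>c\<close> expands \<open>\<Xi>\<^sub>n\<close>. The reciprocal polynomials are orthogonal to \<open>z, \<dots>, z\<^sup>n\<close> instead and are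
  treated in the same way.\<close>

section \<open>Integrals over the unit circle\<close>

text \<open>The derivative \<open>2 pi i \<zeta>\<close> of the parametrisation cancels the
  denominator.\<close>

lemma circle_int_eq_integral:
  "circle_int f = integral {0..1} (\<lambda>t. f (circlepath 0 1 t))"
  unfolding circle_int_def contour_integral_integral
  by (intro integral_cong) (simp add: vector_derivative_circlepath, simp add: circlepath)

lemma circle_int_cong:
  assumes "\<And>\<zeta>. norm \<zeta> = 1 \<Longrightarrow> f \<zeta> = g \<zeta>"
  shows "circle_int f = circle_int g"
  unfolding circle_int_eq_integral by (intro integral_cong assms) (simp add: circlepath)

lemma circle_int_0 [simp]: "circle_int (\<lambda>\<zeta>. 0) = 0"
  by (simp add: circle_int_eq_integral)

text \<open>The weight is merely integrable, but the other factor is continuous on a compact set and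
  hence bounded.\<close>

lemma absolutely_integrable_weight_mult:
  assumes "circle_weight w" "continuous_on (sphere 0 1) f"
  shows "(\<lambda>t. w (circlepath 0 1 t) * f (circlepath 0 1 t)) absolutely_integrable_on {0..1}"
proof -
  have "continuous_on {0..1} (\<lambda>t. circlepath 0 1 t)"
    unfolding circlepath by (intro continuous_intros)
  then have c: "continuous_on {0..1} (\<lambda>t. f (circlepath 0 1 t))"
    by (rule continuous_on_compose2[OF assms(2)]) (auto simp: circlepath)
  then have "compact ((\<lambda>t. f (circlepath 0 1 t)) ` {0..1})"
    by (intro compact_continuous_image) auto
  then have b: "bounded ((\<lambda>t. f (circlepath 0 1 t)) ` {0..1})"
    by (rule compact_imp_bounded)
  have "(\<lambda>t. f (circlepath 0 1 t) * w (circlepath 0 1 t)) absolutely_integrable_on {0..1}"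
    by (rule absolutely_integrable_bounded_measurable_product[OF bilinear_times
          continuous_imp_measurable_on_sets_lebesgue[OF c] _ b assms(1)[unfolded circle_weight_def]])
      simp_all
  then show ?thesis by (simp add: mult.commute)
qed

lemma integrable_weight_mult:
  assumes "circle_weight w" "continuous_on (sphere 0 1) f"
  shows "(\<lambda>t. w (circlepath 0 1 t) * f (circlepath 0 1 t)) integrable_on {0..1}"
  using absolutely_integrable_weight_mult[OF assms] set_lebesgue_integral_eq_integral(1) by blast

lemma circle_weight_mult:
  assumes "circle_weight w" "continuous_on (sphere 0 1) f"
  shows "circle_weight (\<lambda>\<zeta>. f \<zeta> * w \<zeta>)"
  using absolutely_integrable_weight_mult[OF assms]
  by (simp add: circle_weight_def mult.commute)

lemma circle_int_add:
  assumes "circle_weight w" "continuous_on (sphere 0 1) f" "continuous_on (sphere 0 1) g"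
  shows "circle_int (\<lambda>\<zeta>. w \<zeta> * (f \<zeta> + g \<zeta>)) =
    circle_int (\<lambda>\<zeta>. w \<zeta> * f \<zeta>) + circle_int (\<lambda>\<zeta>. w \<zeta> * g \<zeta>)"
  unfolding circle_int_eq_integral ring_distribs
  by (intro Henstock_Kurzweil_Integration.integral_add integrable_weight_mult assms)

lemma circle_int_mult_left:
  "circle_int (\<lambda>\<zeta>. w \<zeta> * (c * f \<zeta>)) = c * circle_int (\<lambda>\<zeta>. w \<zeta> * f \<zeta>)"
  unfolding circle_int_eq_integral
  by (subst integral_mult_right[symmetric]) (simp add: algebra_simps)

lemma circle_int_sum:
  assumes "circle_weight w" "\<And>i. i \<in> A \<Longrightarrow> continuous_on (sphere 0 1) (f i)"
  shows "circle_int (\<lambda>\<zeta>. w \<zeta> * (\<Sum>i\<in>A. f i \<zeta>)) = (\<Sum>i\<in>A. circle_int (\<lambda>\<zeta>. w \<zeta> * f i \<zeta>))"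
  using assms(2)
proof (induction A rule: infinite_finite_induct)
  case (insert a A)
  then show ?case
    by (simp add: circle_int_add[OF assms(1)] continuous_on_sum)
qed auto

lemma continuous_on_inverse_power_sphere [continuous_intros]:
  "continuous_on (sphere 0 1) (\<lambda>\<zeta>::complex. inverse \<zeta> ^ k)"
  by (intro continuous_intros) auto

section \<open>Linear algebra and polynomials\<close>

text \<open>Dividing by \<open>[:-a, 1:]\<close> keeps every other root \<open>b\<close>, because
  \<open>b - a\<close> is nonzero.\<close>

lemma prod_linear_factors_dvd:
  fixes f :: "'a :: field poly"
  assumes "finite S" "\<And>a. a \<in> S \<Longrightarrow> poly f a = 0"
  shows "(\<Prod>a\<in>S. [:-a, 1:]) dvd f"
  using assms
proof (induction S arbitrary: f rule: finite_induct)
  case (insert a S)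
  then obtain g where g: "f = [:-a, 1:] * g"
    by (metis dvdE insertI1 poly_eq_0_iff_dvd)
  have "poly g b = 0" if "b \<in> S" for b
    using insert.prems[of b] insert.hyps(2) that by (auto simp: g)
  then show ?case
    using insert by (auto simp del: mult_pCons_left simp: g intro!: mult_dvd_mono)
qed auto

text \<open>Polynomials \<open>b i\<close> of every degree \<open>i < m\<close> form a triangular
  basis: the leading term of \<open>p\<close> is eliminated with \<open>b d\<close>, and the degree
  drops. This later extends orthogonality from a bi-orthogonal family to all polynomials of lower
  degree.\<close>

lemma linear_functional_eq_0:
  fixes T :: "'a :: field poly \<Rightarrow> 'a"
  assumes add: "\<And>p q. T (p + q) = T p + T q" and smult: "\<And>c p. T (Polynomial.smult c p) = c * T p"
    and deg: "\<And>i. i < m \<Longrightarrow> degree (b i) = i \<and> b i \<noteq> 0 \<and> T (b i) = 0"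
    and p: "p = 0 \<or> degree p < m"
  shows "T p = 0"
  using p
proof (induction "degree p" arbitrary: p rule: less_induct)
  case less
  show ?case
  proof (cases "p = 0")
    case True
    then show ?thesis using smult[of 0 0] by simp
  next
    case False
    define d where "d = degree p"
    with False less.prems have d: "d < m" by simp
    define c where "c = lead_coeff p / lead_coeff (b d)"
    define r where "r = p - Polynomial.smult c (b d)"
    have "coeff (b d) d \<noteq> 0" using deg[OF d] by (metis leading_coeff_0_iff)
    then have "coeff r d = 0"
      using deg[OF d] by (simp add: r_def c_def d_def)
    moreover have "degree r \<le> d"
      using deg[OF d] unfolding r_def d_def by (intro degree_diff_le order_trans[OF degree_smult_le]) auto
    ultimately have "r = 0 \<or> degree r < d"
      by (metis leading_coeff_0_iff order_le_imp_less_or_eq)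
    then have "T r = 0"
      using less.hyps[of r] d smult[of 0 0] by (auto simp: d_def)
    moreover have "T p = T r + c * T (b d)"
      using add[of r "Polynomial.smult c (b d)"] smult by (simp add: r_def)
    ultimately show ?thesis using deg[OF d] by simp
  qed
qed

text \<open>Since \<open>c\<close> is orthogonal to all of \<open>B\<close>, the vector
  \<open>N x *\<^sub>v c\<close> is zero except for the entry \<open>x \<bullet> c\<close> in row 0.
  Applying the adjugate and reading entry \<open>j\<close> gives
  \<open>det (N x) * c $ j = (x \<bullet> c) * M\<close> with a cofactor \<open>M\<close> that does
  not depend on \<open>x\<close>.\<close>

lemma bordered_det_eq:
  fixes B :: "'a :: field Matrix.vec list"
  assumes len: "length B = K" and B: "set B \<subseteq> carrier_vec (K + 1)"
    and c: "c \<in> carrier_vec (K + 1)" "c \<noteq> 0\<^sub>v (K + 1)"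
    and Bc: "\<And>b. b \<in> set B \<Longrightarrow> b \<bullet> c = 0"
    and ker: "\<And>d. d \<in> carrier_vec (K + 1) \<Longrightarrow> (\<And>b. b \<in> set B \<Longrightarrow> b \<bullet> d = 0) \<Longrightarrow> \<exists>t. d = t \<cdot>\<^sub>v c"
  shows "\<exists>C. \<forall>x\<in>carrier_vec (K + 1). x \<bullet> c = C * Determinant.det (mat_of_rows (K + 1) (x # B))"
proof -
  define N where "N x = mat_of_rows (K + 1) (x # B)" for x
  have N: "N x \<in> carrier_mat (K + 1) (K + 1)" for x
    using mat_of_rows_carrier(1)[of "K + 1" "x # B"] by (simp add: N_def len)
  have Nv: "N x *\<^sub>v d = Matrix.vec (K + 1) (\<lambda>i. ((x # B) ! i) \<bullet> d)"
    if "x \<in> carrier_vec (K + 1)" for x d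
  proof (rule eq_vecI)
    fix i assume "i < dim_vec (Matrix.vec (K + 1) (\<lambda>i. ((x # B) ! i) \<bullet> d))"
    then have i: "i < K + 1" by simp
    have "set (x # B) \<subseteq> carrier_vec (K + 1)" using that B by simp
    then have "(x # B) ! i \<in> carrier_vec (K + 1)"
      using nth_mem[of i "x # B"] i len by auto
    then have "row (N x) i = (x # B) ! i"
      using i len by (simp add: N_def del: nth_Cons_pos)
    then show "(N x *\<^sub>v d) $ i = Matrix.vec (K + 1) (\<lambda>i. ((x # B) ! i) \<bullet> d) $ i"
      using i N[of x] by simp
  qed (use carrier_matD(1)[OF N[of x]] in simp)
  obtain j where j: "j < K + 1" "c $ j \<noteq> 0"
    using c eq_vecI[of c "0\<^sub>v (K + 1)"] by auto
  \<comment> \<open>This cofactor deletes row 0, so taking \<open>c\<close> as the first row is an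
    arbitrary choice.\<close>
  define M where "M = cofactor (N c) 0 j"
  have cof: "cofactor (N x) 0 j = M" for x
    unfolding M_def cofactor_def
    by (intro arg_cong2[where f = "(*)"] arg_cong[where f = Determinant.det] refl eq_matI)
      (auto simp: mat_delete_def N_def mat_of_rows_def)
  have key: "Determinant.det (N x) * c $ j = (x \<bullet> c) * M" if x: "x \<in> carrier_vec (K + 1)" for x
  proof -
    have Nc: "N x *\<^sub>v c = Matrix.vec (K + 1) (\<lambda>i. if i = 0 then x \<bullet> c else 0)"
      unfolding Nv[OF x] using Bc len by (intro eq_vecI) (auto simp: nth_Cons')
    have "adj_mat (N x) *\<^sub>v (N x *\<^sub>v c) = (adj_mat (N x) * N x) *\<^sub>v c"
      using adj_mat(1)[OF N] N c(1) by (metis assoc_mult_mat_vec)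
    also have "\<dots> = Determinant.det (N x) \<cdot>\<^sub>v c"
      unfolding adj_mat(3)[OF N] using c(1)
      by (intro eq_vecI) (auto simp: row_one smult_scalar_prod_distrib[of _ "K + 1"])
    finally have "Determinant.det (N x) * c $ j = (adj_mat (N x) *\<^sub>v (N x *\<^sub>v c)) $ j"
      using j c(1) by simp
    also have "\<dots> = adj_mat (N x) $$ (j, 0) * (x \<bullet> c)"
      unfolding Nc using adj_mat(1)[OF N, of x] j
      by (simp add: scalar_prod_def if_distrib if_distribR sum.delta cong: if_cong)
    also have "adj_mat (N x) $$ (j, 0) = M"
      using N[of x] j by (simp add: adj_mat_def cof)
    finally show ?thesis by simp
  qed
  \<comment> \<open>This first row shows that \<open>M\<close> is nonzero: by \<open>ker\<close> a
    kernel vector of \<open>N ?e\<close> has the form \<open>t \<cdot>\<^sub>v c\<close>, and row 0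
    then forces \<open>t * c $ j = 0\<close>.\<close>
  let ?e = "unit_vec (K + 1) j"
  have e: "?e \<bullet> c = c $ j" using j c by simp
  have "Determinant.det (N ?e) \<noteq> 0"
  proof
    assume "Determinant.det (N ?e) = 0"
    then obtain d where d: "d \<in> carrier_vec (K + 1)" "d \<noteq> 0\<^sub>v (K + 1)" "N ?e *\<^sub>v d = 0\<^sub>v (K + 1)"
      using det_0_iff_vec_prod_zero[OF N] by blast
    have row: "((?e # B) ! i) \<bullet> d = 0" if "i < K + 1" for i
      using arg_cong[OF d(3), of "\<lambda>v. v $ i"] that by (simp add: Nv)
    have "b \<bullet> d = 0" if "b \<in> set B" for b
    proof -
      from that obtain i where "i < K" "b = B ! i" by (auto simp: in_set_conv_nth len)
      then show ?thesis using row[of "Suc i"] by simp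
    qed
    with ker d(1) obtain t where t: "d = t \<cdot>\<^sub>v c" by blast
    have "d $ j = 0" using row[of 0] j d(1) by simp
    then have "t = 0" using t j c(1) by simp
    then show False using t d(2) c(1) by auto
  qed
  then have M: "M \<noteq> 0" using key[of ?e] e j by auto
  show ?thesis
  proof (intro exI ballI)
    fix x :: "'a Matrix.vec" assume "x \<in> carrier_vec (K + 1)"
    from key[OF this] M show "x \<bullet> c = (c $ j / M) * Determinant.det (mat_of_rows (K + 1) (x # B))"
      by (simp add: N_def field_simps)
  qed
qed

section \<open>Orthogonality\<close>

text \<open>The parameter \<open>s\<close> is 0 for the polynomials \<open>\<phi>\<^sub>n\<close> and 1 for the reciprocal ones.\<close>

definition annihilated :: "(complex \<Rightarrow> complex) \<Rightarrow> nat \<Rightarrow> nat \<Rightarrow> complex poly \<Rightarrow> bool" where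
  "annihilated w s m p \<longleftrightarrow>
     (\<forall>k. s \<le> k \<and> k < s + m \<longrightarrow> circle_int (\<lambda>\<zeta>. w \<zeta> * (poly p \<zeta> * inverse \<zeta> ^ k)) = 0)"

lemma continuous_on_poly_inverse_power:
  "continuous_on (sphere 0 1) (\<lambda>\<zeta>. poly p \<zeta> * inverse \<zeta> ^ k)" for p :: "complex poly"
  by (intro continuous_intros) auto

lemma circle_int_poly_add:
  assumes "circle_weight w"
  shows "circle_int (\<lambda>\<zeta>. w \<zeta> * (poly (p + q) \<zeta> * inverse \<zeta> ^ k)) =
    circle_int (\<lambda>\<zeta>. w \<zeta> * (poly p \<zeta> * inverse \<zeta> ^ k)) +
    circle_int (\<lambda>\<zeta>. w \<zeta> * (poly q \<zeta> * inverse \<zeta> ^ k))"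
  using circle_int_add[OF assms continuous_on_poly_inverse_power[of p k] continuous_on_poly_inverse_power[of q k]]
  by (simp add: distrib_right)

lemma circle_int_poly_smult:
  "circle_int (\<lambda>\<zeta>. w \<zeta> * (poly (Polynomial.smult c p) \<zeta> * inverse \<zeta> ^ k)) =
    c * circle_int (\<lambda>\<zeta>. w \<zeta> * (poly p \<zeta> * inverse \<zeta> ^ k))"
  by (simp add: circle_int_mult_left[symmetric] mult.assoc)

lemma annihilated_add:
  "circle_weight w \<Longrightarrow> annihilated w s m p \<Longrightarrow> annihilated w s m q \<Longrightarrow> annihilated w s m (p + q)"
  by (simp add: annihilated_def circle_int_poly_add del: poly_add)

lemma annihilated_smult:
  "annihilated w s m p \<Longrightarrow> annihilated w s m (Polynomial.smult c p)"
  by (simp add: annihilated_def circle_int_poly_smult del: poly_smult)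

lemma annihilated_diff_smult:
  "circle_weight w \<Longrightarrow> annihilated w s m p \<Longrightarrow> annihilated w s m q \<Longrightarrow>
    annihilated w s m (p - Polynomial.smult c q)"
  using annihilated_add[of w s m p "Polynomial.smult (- c) q"] annihilated_smult[of w s m q "- c"]
  by simp

lemma annihilated_mono:
  "annihilated w s m p \<Longrightarrow> s \<le> t \<Longrightarrow> t + k \<le> s + m \<Longrightarrow> annihilated w t k p"
  by (auto simp: annihilated_def)

lemma circle_int_pCons_inverse:
  "circle_int (\<lambda>\<zeta>. w \<zeta> * (poly (pCons 0 p) \<zeta> * inverse \<zeta> ^ Suc k)) =
   circle_int (\<lambda>\<zeta>. w \<zeta> * (poly p \<zeta> * inverse \<zeta> ^ k))"
  by (intro circle_int_cong) (auto simp: field_simps)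

text \<open>On the circle, the extra factor \<open>\<zeta>\<close> cancels one power of
  \<open>inverse \<zeta>\<close>. Inductions can thus trade a factor of the variable for a shift of
  the window of exponents.\<close>

lemma annihilated_pCons: "annihilated w (Suc s) m (pCons 0 p) \<longleftrightarrow> annihilated w s m p"
proof -
  have "(\<forall>k. Suc s \<le> k \<and> k < Suc s + m \<longrightarrow> P k) \<longleftrightarrow> (\<forall>k. s \<le> k \<and> k < s + m \<longrightarrow> P (Suc k))" for P
    by (metis Suc_le_D Suc_le_mono Suc_less_eq add_Suc)
  then show ?thesis
    unfolding annihilated_def circle_int_pCons_inverse by (simp only: circle_int_pCons_inverse)
qed

text \<open>The vanishing integrals say that the coefficient vector of \<open>p\<close> lies in the
  kernel of the Toeplitz matrix of size \<open>n\<close>, whose row index is the exponent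
  \<open>k\<close>.\<close>

lemma annihilated_eq_0:
  assumes w: "circle_weight w" and T: "toeplitz_det w n \<noteq> 0"
    and p: "annihilated w 0 n p" "\<And>i. i \<ge> n \<Longrightarrow> coeff p i = 0"
  shows "p = 0"
proof (rule ccontr)
  assume "p \<noteq> 0"
  then obtain i where i: "coeff p i \<noteq> 0" by (metis leading_coeff_0_iff)
  with p(2) have "i < n" by (meson not_le)
  let ?v = "Matrix.vec n (\<lambda>i. coeff p i)"
  let ?T = "Matrix.mat n n (\<lambda>(j, k). moment w (int j - int k))"
  have "p = (\<Sum>i<n. monom (coeff p i) i)"
    using p(2) by (intro poly_eqI) (auto simp: coeff_sum)
  then have poly: "poly p z = (\<Sum>i<n. coeff p i * z ^ i)" for z
    by (metis (no_types, lifting) poly_monom poly_sum sum.cong)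
  have powi: "\<zeta> ^ i * inverse \<zeta> ^ k = \<zeta> powi (int i - int k)" if "norm \<zeta> = 1" for \<zeta> :: complex and i k
  proof -
    from that have "\<zeta> \<noteq> 0" by auto
    then show ?thesis by (simp add: power_int_diff power_inverse field_simps)
  qed
  have "(\<Sum>i<n. moment w (int k - int i) * coeff p i) = 0" if "k < n" for k
  proof -
    have "0 = circle_int (\<lambda>\<zeta>. w \<zeta> * (poly p \<zeta> * inverse \<zeta> ^ k))"
      using p(1) that by (auto simp: annihilated_def)
    also have "\<dots> = circle_int (\<lambda>\<zeta>. w \<zeta> * (\<Sum>i<n. coeff p i * (\<zeta> ^ i * inverse \<zeta> ^ k)))"
      by (simp add: poly sum_distrib_right mult.assoc)
    also have "\<dots> = (\<Sum>i<n. circle_int (\<lambda>\<zeta>. w \<zeta> * (coeff p i * (\<zeta> ^ i * inverse \<zeta> ^ k))))"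
      by (intro circle_int_sum w continuous_intros) auto
    also have "\<dots> = (\<Sum>i<n. coeff p i * moment w (int k - int i))"
      unfolding circle_int_mult_left moment_def
      by (intro sum.cong refl arg_cong2[where f = "(*)"] circle_int_cong)
        (simp add: powi)
    finally show ?thesis by (simp add: mult.commute)
  qed
  then have "?T *\<^sub>v ?v = 0\<^sub>v n"
    by (intro eq_vecI) (auto simp: scalar_prod_def atLeast0LessThan)
  moreover have "?v \<noteq> 0\<^sub>v n" using i \<open>i < n\<close> by (metis index_vec index_zero_vec(1))
  ultimately have "toeplitz_det w n = 0"
    unfolding toeplitz_det_def
    by (subst det_0_iff_vec_prod_zero[of _ n]) (auto intro!: exI[of _ ?v])
  with T show False by simp
qed

text \<open>The coefficient that must not vanish is the leading one for \<open>s = 0\<close> and the constant one for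
  \<open>s = 1\<close>.\<close>

lemma annihilated_unique:
  assumes w: "circle_weight w" and T: "toeplitz_det w n \<noteq> 0" and s: "s \<le> 1"
    and p: "annihilated w s n p" "degree p \<le> n" "coeff p ((1 - s) * n) \<noteq> 0"
    and q: "annihilated w s n q" "degree q \<le> n"
  obtains c where "q = Polynomial.smult c p"
proof -
  define c where "c = coeff q ((1 - s) * n) / coeff p ((1 - s) * n)"
  define r where "r = q - Polynomial.smult c p"
  have r: "annihilated w s n r" unfolding r_def by (intro annihilated_diff_smult w p q)
  have deg: "coeff r i = 0" if "i > n" for i
    using that p(2) q(2) by (simp add: r_def coeff_eq_0)
  have 0: "coeff r ((1 - s) * n) = 0" using p(3) by (simp add: r_def c_def)
  have "r = 0"
  proof (cases "s = 0")
    case True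
    then show ?thesis
      using annihilated_eq_0[OF w T, of r] r 0 deg by (metis le_neq_implies_less diff_zero mult_1)
  next
    case False
    with s have [simp]: "s = 1" by simp
    \<comment> \<open>Here the constant coefficient is the one that vanishes. Removing the variable
      turns the exponents 1 to \<open>n\<close> for \<open>r\<close> into 0 to \<open>n - 1\<close>
      for \<open>r'\<close>.\<close>
    obtain r' where r': "r = pCons 0 r'"
      using 0 by (cases r) auto
    have "r' = 0"
      using r deg[of "Suc i" for i] unfolding r'
      by (intro annihilated_eq_0[OF w T]) (auto simp: annihilated_pCons)
    then show ?thesis by (simp add: r')
  qed
  then show ?thesis using that[of c] by (simp add: r_def)
qed

section \<open>Combinations of shifted polynomials\<close>

text \<open>The Laurent polynomial with terms \<open>c j * z^(-j) * q j\<close>, multiplied by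
  \<open>z^K\<close>. The Horner form keeps it a polynomial and isolates the term with index
  \<open>K\<close>, the only one not divisible by the variable.\<close>

primrec shifted_comb :: "(nat \<Rightarrow> 'a :: comm_ring_1 poly) \<Rightarrow> (nat \<Rightarrow> 'a) \<Rightarrow> nat \<Rightarrow> 'a poly" where
  "shifted_comb q c 0 = Polynomial.smult (c 0) (q 0)"
| "shifted_comb q c (Suc K) = pCons 0 (shifted_comb q c K) + Polynomial.smult (c (Suc K)) (q (Suc K))"

lemma poly_shifted_comb:
  fixes z :: "'a :: field"
  assumes "z \<noteq> 0"
  shows "poly (shifted_comb q c K) z = z ^ K * (\<Sum>j\<le>K. c j * (inverse z ^ j * poly (q j) z))"
  using assms by (induction K) (auto simp: algebra_simps power_inverse)

lemma shifted_comb_cong: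
  "(\<And>j. j \<le> K \<Longrightarrow> c j = d j) \<Longrightarrow> shifted_comb q c K = shifted_comb q d K"
  by (induction K) auto

lemma shifted_comb_diff:
  "shifted_comb q (\<lambda>j. c j - t * d j) K =
    shifted_comb q c K - Polynomial.smult t (shifted_comb q d K)"
  by (induction K) (auto simp: algebra_simps smult_diff_left smult_add_right simp flip: diff_pCons)

lemma degree_shifted_comb:
  assumes "\<And>j. j \<le> K \<Longrightarrow> degree (q j) \<le> n + j"
  shows "degree (shifted_comb q c K) \<le> n + K"
  using assms
proof (induction K)
  case (Suc K)
  then have "degree (shifted_comb q c K) \<le> n + K" by simp
  then have "degree (pCons 0 (shifted_comb q c K)) \<le> n + Suc K"
    using degree_pCons_le[of 0 "shifted_comb q c K"] by simp
  moreover have "degree (Polynomial.smult (c (Suc K)) (q (Suc K))) \<le> n + Suc K"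
    using Suc.prems[of "Suc K"] degree_smult_le order_trans by blast
  ultimately show ?case by (auto intro: degree_add_le)
qed (metis add_0_right degree_smult_le le_refl order_trans shifted_comb.simps(1))

text \<open>Linear independence of the shifted polynomials: the constant term of the combination is
  \<open>c K * coeff (q K) 0\<close>, so \<open>c K\<close> vanishes, and the variable can be
  divided out.\<close>

lemma shifted_comb_eq_0:
  fixes q :: "nat \<Rightarrow> 'a :: idom poly"
  assumes "shifted_comb q c K = 0" "\<And>j. j \<le> K \<Longrightarrow> coeff (q j) 0 \<noteq> 0" "j \<le> K"
  shows "c j = 0"
  using assms
proof (induction K arbitrary: j)
  case 0
  then show ?case by (metis coeff_0 le_zero_eq shifted_comb.simps(1) smult_eq_0_iff)
next
  case (Suc K)
  have "c (Suc K) * coeff (q (Suc K)) 0 = 0"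
    using arg_cong[OF Suc.prems(1), of "\<lambda>p. coeff p 0"] by simp
  with Suc.prems(2) have c: "c (Suc K) = 0" by simp
  with Suc.prems(1) have "shifted_comb q c K = 0" by simp
  with Suc c show ?case by (metis le_Suc_eq)
qed

text \<open>The shift moves the window of the previous combination up by one. The window of
  \<open>q (Suc K)\<close> has the same upper end as the new one and starts lower.\<close>

lemma annihilated_shifted_comb:
  assumes w: "circle_weight w" and q: "\<And>j. j \<le> K \<Longrightarrow> annihilated w s (n + j) (q j)"
  shows "annihilated w (s + K) n (shifted_comb q c K)"
  using q
proof (induction K)
  case 0
  then show ?case by (simp add: annihilated_smult)
next
  case (Suc K)
  then have "annihilated w (s + Suc K) n (pCons 0 (shifted_comb q c K))"
    by (simp add: annihilated_pCons)
  moreover have "annihilated w (s + Suc K) n (q (Suc K))"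
    by (rule annihilated_mono[OF Suc.prems[of "Suc K"]]) auto
  ultimately show ?case
    by (simp add: annihilated_add annihilated_smult w)
qed

text \<open>Subtracting a multiple of \<open>q K\<close> removes the constant term, and the rest is divisible by the
  variable.\<close>

lemma annihilated_imp_shifted_comb:
  assumes w: "circle_weight w" and T: "toeplitz_det w n \<noteq> 0" and s: "s \<le> 1"
    and q: "\<And>j. j \<le> K \<Longrightarrow> annihilated w s (n + j) (q j)" "\<And>j. j \<le> K \<Longrightarrow> degree (q j) \<le> n + j"
      "\<And>j. j \<le> K \<Longrightarrow> coeff (q j) 0 \<noteq> 0" "coeff (q 0) ((1 - s) * n) \<noteq> 0"
    and f: "annihilated w (s + K) n f" "degree f \<le> n + K"
  shows "\<exists>c. f = shifted_comb q c K"
  using q f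
proof (induction K arbitrary: f)
  case 0
  then obtain c where "f = Polynomial.smult c (q 0)"
    using annihilated_unique[OF w T s, of "q 0" f] by auto
  then have "f = shifted_comb q (\<lambda>_. c) 0" by simp
  then show ?case by blast
next
  case (Suc K)
  define t where "t = coeff f 0 / coeff (q (Suc K)) 0"
  have "coeff (f - Polynomial.smult t (q (Suc K))) 0 = 0"
    using Suc.prems(3)[of "Suc K"] by (simp add: t_def)
  then obtain g where g: "f - Polynomial.smult t (q (Suc K)) = pCons 0 g"
    by (cases "f - Polynomial.smult t (q (Suc K))") auto
  have "annihilated w (s + Suc K) n (q (Suc K))"
    by (rule annihilated_mono[OF Suc.prems(1)[of "Suc K"]]) auto
  then have "annihilated w (s + Suc K) n (pCons 0 g)"
    unfolding g[symmetric] using Suc.prems by (intro annihilated_diff_smult w) auto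
  then have "annihilated w (s + K) n g" by (simp add: annihilated_pCons)
  moreover have "degree (pCons 0 g) \<le> n + Suc K"
    unfolding g[symmetric] using Suc.prems(2)[of "Suc K"] Suc.prems(6)
    by (intro degree_diff_le order_trans[OF degree_smult_le]) auto
  then have "degree g \<le> n + K" by (auto split: if_splits)
  ultimately obtain c where c: "g = shifted_comb q c K"
    using Suc.IH[of g] Suc.prems by auto
  have "f = shifted_comb q (c(Suc K := t)) (Suc K)"
    using g c shifted_comb_cong[of K c "c(Suc K := t)" q] by (simp add: algebra_simps)
  then show ?case by blast
qed

section \<open>Expansion of the modified polynomials\<close>

text \<open>The Christoffel factor cleared of negative powers.\<close>

definition linear_prod :: "nat \<Rightarrow> (nat \<Rightarrow> complex) \<Rightarrow> complex poly" where
  "linear_prod K \<alpha> = (\<Prod>j=1..K. [:- \<alpha> j, 1:])"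

lemma linear_prod_neq_0: "linear_prod K \<alpha> \<noteq> 0"
  by (simp add: linear_prod_def)

lemma degree_linear_prod: "degree (linear_prod K \<alpha>) = K"
  unfolding linear_prod_def by (subst degree_prod_eq_sum_degree) auto

lemma poly_linear_prod:
  "z \<noteq> 0 \<Longrightarrow> poly (linear_prod K \<alpha>) z = z ^ K * christoffel_factor K \<alpha> z"
proof -
  assume z: "z \<noteq> 0"
  have "poly (linear_prod K \<alpha>) z = (\<Prod>j=1..K. z * (1 - \<alpha> j * inverse z))"
    unfolding linear_prod_def poly_prod using z by (intro prod.cong) (auto simp: field_simps)
  then show ?thesis
    by (simp add: christoffel_factor_def prod.distrib)
qed

lemma poly_linear_prod_root: "j \<in> {1..K} \<Longrightarrow> poly (linear_prod K \<alpha>) (\<alpha> j) = 0"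
  by (auto simp: linear_prod_def poly_prod)

text \<open>Distinctness of the nodes enters here: it makes the indexed product a product over the
  set of roots.\<close>

lemma linear_prod_dvd:
  assumes "inj_on \<alpha> {1..K}" "\<And>j. j \<in> {1..K} \<Longrightarrow> poly f (\<alpha> j) = 0"
  shows "linear_prod K \<alpha> dvd f"
proof -
  have "linear_prod K \<alpha> = (\<Prod>a\<in>\<alpha> ` {1..K}. [:- a, 1:])"
    using assms(1) by (simp add: linear_prod_def prod.reindex)
  also have "\<dots> dvd f" using assms(2) by (intro prod_linear_factors_dvd) auto
  finally show ?thesis .
qed

lemma circle_weight_modified:
  assumes "circle_weight w"
  shows "circle_weight (modified_weight K \<alpha> w)"
  unfolding modified_weight_def christoffel_factor_def
  by (intro circle_weight_mult assms continuous_intros) auto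

text \<open>On the circle the Christoffel factor is \<open>linear_prod K \<alpha>\<close> times
  \<open>inverse \<zeta> ^ K\<close>; the polynomial joins \<open>q\<close>, and the power is
  absorbed into the window.\<close>

lemma annihilated_modified_weight:
  "annihilated (modified_weight K \<alpha> w) s n q \<longleftrightarrow> annihilated w (s + K) n (linear_prod K \<alpha> * q)"
proof -
  have eq: "circle_int (\<lambda>\<zeta>. modified_weight K \<alpha> w \<zeta> * (poly q \<zeta> * inverse \<zeta> ^ k)) =
      circle_int (\<lambda>\<zeta>. w \<zeta> * (poly (linear_prod K \<alpha> * q) \<zeta> * inverse \<zeta> ^ (k + K)))" for k
  proof (rule circle_int_cong)
    fix \<zeta> :: complex assume "norm \<zeta> = 1"
    then have "\<zeta> \<noteq> 0" by auto
    then show "modified_weight K \<alpha> w \<zeta> * (poly q \<zeta> * inverse \<zeta> ^ k) =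
        w \<zeta> * (poly (linear_prod K \<alpha> * q) \<zeta> * inverse \<zeta> ^ (k + K))"
      by (simp add: poly_linear_prod modified_weight_def power_add field_simps power_inverse)
  qed
  have "(\<forall>k. s \<le> k \<and> k < s + n \<longrightarrow> R (k + K)) \<longleftrightarrow> (\<forall>k. s + K \<le> k \<and> k < s + K + n \<longrightarrow> R k)" for R
  proof (intro iffI allI impI)
    fix k assume *: "\<forall>k. s \<le> k \<and> k < s + n \<longrightarrow> R (k + K)" "s + K \<le> k \<and> k < s + K + n"
    then show "R k" using *(1)[rule_format, of "k - K"] by (simp add: less_diff_conv2 le_diff_conv2)
  qed simp
  then show ?thesis unfolding annihilated_def eq .
qed

lemma scalar_prod_vrow:
  "vrow K n a z \<bullet> Matrix.vec (K + 1) c = (\<Sum>j\<le>K. c j * (inverse z ^ j * a (n + j) z))"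
  unfolding scalar_prod_def
  by (intro sum.cong) (auto simp: vrow_def)

text \<open>One argument for both families, with \<open>s\<close> selecting the window. The second
  conclusion allows any sequence \<open>a\<close>, so that the same constant \<open>C\<close> also
  serves the associated functions.\<close>

lemma christoffel_expansion:
  fixes p :: "nat \<Rightarrow> complex poly"
  assumes w: "circle_weight w" and s: "s \<le> 1"
    and \<alpha>: "inj_on \<alpha> {1..K}" "\<And>j. j \<in> {1..K} \<Longrightarrow> \<alpha> j \<noteq> 0"
    and T: "toeplitz_det w n \<noteq> 0" "toeplitz_det (modified_weight K \<alpha> w) n \<noteq> 0"
    and p: "\<And>m. annihilated w s m (p m)" "\<And>m. degree (p m) \<le> m" "\<And>m. coeff (p m) 0 \<noteq> 0"
      "coeff (p n) ((1 - s) * n) \<noteq> 0"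
    and P: "annihilated (modified_weight K \<alpha> w) s n P" "degree P \<le> n" "coeff P ((1 - s) * n) \<noteq> 0"
  shows "\<exists>C c.
    (\<forall>z. z \<noteq> 0 \<longrightarrow> christoffel_factor K \<alpha> z * poly P z =
      (\<Sum>j\<le>K. c j * (inverse z ^ j * poly (p (n + j)) z))) \<and>
    (\<forall>a z. (\<Sum>j\<le>K. c j * (inverse z ^ j * a (n + j) z)) =
      C * christoffel_det K \<alpha> n a (\<lambda>m. poly (p m)) z)"
proof -
  let ?A = "linear_prod K \<alpha>"
  define q where "q j = p (n + j)" for j
  define row where "row i = vrow K n (\<lambda>m. poly (p m)) (\<alpha> i)" for i
  have q0: "coeff (q j) 0 \<noteq> 0" for j using p(3) by (simp add: q_def)
  have qan: "annihilated w s (n + j) (q j)" for j using p(1) by (simp add: q_def)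
  have qdeg: "degree (q j) \<le> n + j" for j using p(2) by (simp add: q_def)
  have ev: "z ^ K * (\<Sum>j\<le>K. d j * (inverse z ^ j * poly (p (n + j)) z)) = poly (shifted_comb q d K) z"
    if "z \<noteq> 0" for d z
    using that by (simp add: poly_shifted_comb q_def)
  have row: "row i \<bullet> Matrix.vec (K + 1) d = 0 \<longleftrightarrow> poly (shifted_comb q d K) (\<alpha> i) = 0"
    if "i \<in> {1..K}" for i d
    unfolding row_def scalar_prod_vrow ev[OF \<alpha>(2)[OF that], symmetric] using \<alpha>(2)[OF that] by simp
  \<comment> \<open>With its degree bound, this places \<open>?A * P\<close> in the space spanned by
    the shifted polynomials.\<close>
  have "annihilated w (s + K) n (?A * P)"
    using P(1) by (simp add: annihilated_modified_weight)
  moreover have "degree (?A * P) \<le> n + K"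
    using degree_mult_le[of ?A P] P(2) by (simp add: degree_linear_prod)
  ultimately obtain c where c: "?A * P = shifted_comb q c K"
    using annihilated_imp_shifted_comb[OF w T(1) s, of K q "?A * P"] q0 qan qdeg p(4)
    by (auto simp: q_def)
  let ?c = "Matrix.vec (K + 1) c"
  let ?B = "map row [1..<K + 1]"
  have "?A * P \<noteq> 0" using P(3) linear_prod_neq_0[of K \<alpha>] by auto
  have c0: "?c \<noteq> 0\<^sub>v (K + 1)"
  proof
    assume *: "?c = 0\<^sub>v (K + 1)"
    have "c j = 0" if "j \<le> K" for j
      using arg_cong[OF *, of "\<lambda>v. vec_index v j"] that by simp
    then have "shifted_comb q c K = shifted_comb q (\<lambda>_. 0) K"
      by (intro shifted_comb_cong) auto
    also have "\<dots> = 0" using shifted_comb_diff[of q c 1 c K] by simp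
    finally show False using c \<open>?A * P \<noteq> 0\<close> by simp
  qed
  have ker: "\<exists>t. d = t \<cdot>\<^sub>v ?c" if d: "d \<in> carrier_vec (K + 1)" "\<And>b. b \<in> set ?B \<Longrightarrow> b \<bullet> d = 0" for d
  proof -
    define e where "e = vec_index d"
    have de: "d = Matrix.vec (K + 1) e" using d(1) by (auto simp: e_def)
    have "poly (shifted_comb q e K) (\<alpha> i) = 0" if i: "i \<in> {1..K}" for i
    proof -
      have "row i \<in> set ?B" using i by (auto simp del: upt_Suc)
      then show ?thesis using d(2) row[OF i, of e] by (simp add: de)
    qed
    then obtain Q where Q: "shifted_comb q e K = ?A * Q"
      using linear_prod_dvd[OF \<alpha>(1)] by (metis dvdE)
    have "annihilated w (s + K) n (?A * Q)"
      unfolding Q[symmetric] by (intro annihilated_shifted_comb w qan)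
    then have "annihilated (modified_weight K \<alpha> w) s n Q"
      by (simp add: annihilated_modified_weight)
    moreover have "degree Q \<le> n"
    proof (cases "Q = 0")
      case False
      then have "degree (?A * Q) = K + degree Q"
        by (simp add: degree_mult_eq linear_prod_neq_0 degree_linear_prod)
      moreover have "degree (?A * Q) \<le> n + K"
        unfolding Q[symmetric] by (intro degree_shifted_comb qdeg)
      ultimately show ?thesis by simp
    qed simp
    ultimately obtain t where t: "Q = Polynomial.smult t P"
      using annihilated_unique[OF circle_weight_modified[OF w] T(2) s P] by blast
    \<comment> \<open>Proportional polynomials have proportional coefficients, by linear
      independence.\<close>
    have "shifted_comb q (\<lambda>j. e j - t * c j) K = 0"
      unfolding shifted_comb_diff Q c[symmetric] t by simp
    then have "e j - t * c j = 0" if "j \<le> K" for j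
      using shifted_comb_eq_0[of q _ K j] q0 that by blast
    then have "d = t \<cdot>\<^sub>v ?c" unfolding de by (intro eq_vecI) auto
    then show ?thesis ..
  qed
  have Bc: "b \<bullet> ?c = 0" if "b \<in> set ?B" for b
  proof -
    have "set ?B = row ` {1..K}"
      by (simp add: atLeastLessThanSuc_atLeastAtMost del: upt_Suc)
    with that obtain i where i: "i \<in> {1..K}" "b = row i" by blast
    then show ?thesis using row[OF i(1), of c] poly_linear_prod_root[OF i(1), of \<alpha>] by (simp flip: c)
  qed
  have B: "length ?B = K" "set ?B \<subseteq> carrier_vec (K + 1)"
    by (auto simp: row_def vrow_def simp del: upt_Suc)
  obtain C where C: "\<forall>x\<in>carrier_vec (K + 1). x \<bullet> ?c = C * Determinant.det (mat_of_rows (K + 1) (x # ?B))"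
    using bordered_det_eq[OF _ _ vec_carrier c0 Bc ker] B by blast
  show ?thesis
  proof (intro exI conjI allI impI)
    fix z :: complex assume z: "z \<noteq> 0"
    have "z ^ K * (christoffel_factor K \<alpha> z * poly P z) = poly (?A * P) z"
      using z by (simp add: poly_linear_prod)
    also have "\<dots> = z ^ K * (\<Sum>j\<le>K. c j * (inverse z ^ j * poly (p (n + j)) z))"
      unfolding c using ev[OF z] by simp
    finally show "christoffel_factor K \<alpha> z * poly P z = (\<Sum>j\<le>K. c j * (inverse z ^ j * poly (p (n + j)) z))"
      using z by simp
  next
    fix a :: "nat \<Rightarrow> complex \<Rightarrow> complex" and z
    have "vrow K n a z \<in> carrier_vec (K + 1)" by (simp add: vrow_def)
    with C show "(\<Sum>j\<le>K. c j * (inverse z ^ j * a (n + j) z)) =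
        C * christoffel_det K \<alpha> n a (\<lambda>m. poly (p m)) z"
      unfolding christoffel_det_def scalar_prod_vrow[symmetric] row_def by simp
  qed
qed

section \<open>Associated functions\<close>

text \<open>Off the circle, \<open>assoc\<close> is 2 times the case \<open>s = 0\<close> for
  \<open>\<phi> n\<close>, and \<open>assoc_star\<close> is \<open>- 2 * z\<close> times the case
  \<open>s = 1\<close> for the reciprocal polynomial.\<close>

definition cauchy_transform :: "(complex \<Rightarrow> complex) \<Rightarrow> nat \<Rightarrow> complex poly \<Rightarrow> complex \<Rightarrow> complex" where
  "cauchy_transform w s p z = circle_int (\<lambda>\<zeta>. w \<zeta> * (poly p \<zeta> * \<zeta> ^ (1 - s) / (\<zeta> - z)))"

lemma continuous_on_cauchy_kernel:
  fixes z :: complex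
  assumes "norm z \<noteq> 1" "continuous_on (sphere 0 1) f"
  shows "continuous_on (sphere 0 1) (\<lambda>\<zeta>. f \<zeta> / (\<zeta> - z))"
  using assms by (intro continuous_intros) auto

text \<open>In the inductive step, \<open>1 / (\<zeta> (\<zeta> - z)) = (1 / (\<zeta> - z) - 1 / \<zeta>) / z\<close>, and the second term
  contributes an integral that vanishes by orthogonality.\<close>

lemma circle_int_cauchy_shift:
  assumes w: "circle_weight w" and z: "z \<noteq> 0" "norm z \<noteq> 1" and s: "s \<le> 1"
    and p: "annihilated w s m p" and j: "j \<le> m"
  shows "circle_int (\<lambda>\<zeta>. w \<zeta> * (inverse \<zeta> ^ j * (poly p \<zeta> * \<zeta> ^ (1 - s) / (\<zeta> - z)))) =
    inverse z ^ j * cauchy_transform w s p z"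
  using j
proof (induction j)
  case 0
  then show ?case by (simp add: cauchy_transform_def)
next
  case (Suc j)
  have cont: "continuous_on (sphere 0 1) (\<lambda>\<zeta>. inverse \<zeta> ^ j * (poly p \<zeta> * \<zeta> ^ (1 - s) / (\<zeta> - z)))"
    by (intro continuous_on_cauchy_kernel[OF z(2)] continuous_intros) auto
  have cont': "continuous_on (sphere 0 1) (\<lambda>\<zeta>. - 1 * (poly p \<zeta> * inverse \<zeta> ^ (j + s)))"
    by (intro continuous_intros) auto
  have "circle_int (\<lambda>\<zeta>. w \<zeta> * (inverse \<zeta> ^ Suc j * (poly p \<zeta> * \<zeta> ^ (1 - s) / (\<zeta> - z)))) =
    circle_int (\<lambda>\<zeta>. w \<zeta> * (inverse z * (inverse \<zeta> ^ j * (poly p \<zeta> * \<zeta> ^ (1 - s) / (\<zeta> - z)) +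
      - 1 * (poly p \<zeta> * inverse \<zeta> ^ (j + s)))))"
  proof (rule circle_int_cong)
    fix \<zeta> :: complex assume "norm \<zeta> = 1"
    then have \<zeta>: "\<zeta> \<noteq> 0" "\<zeta> - z \<noteq> 0" using z(2) by auto
    define x where "x = w \<zeta> * poly p \<zeta> * inverse \<zeta> ^ j * \<zeta> ^ (1 - s)"
    have "w \<zeta> * (inverse \<zeta> ^ Suc j * (poly p \<zeta> * \<zeta> ^ (1 - s) / (\<zeta> - z))) =
        x * (inverse \<zeta> * inverse (\<zeta> - z))"
      by (simp add: x_def divide_inverse mult_ac)
    also have "inverse \<zeta> * inverse (\<zeta> - z) = inverse z * (inverse (\<zeta> - z) - inverse \<zeta>)"
      using \<zeta> z(1) by (simp add: field_simps)
    also have "x * \<dots> = inverse z * (x * inverse (\<zeta> - z) + - 1 * (x * inverse \<zeta>))"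
      by (simp add: algebra_simps)
    \<comment> \<open>For \<open>s = 0\<close> the factor \<open>\<zeta>\<close> cancels the new
      inverse; for \<open>s = 1\<close> there is none, and the exponent rises to
      \<open>j + 1\<close>.\<close>
    also have "x * inverse \<zeta> = w \<zeta> * (poly p \<zeta> * inverse \<zeta> ^ (j + s))"
      using s \<zeta>(1) by (cases s) (auto simp: x_def power_add)
    also have "x * inverse (\<zeta> - z) = w \<zeta> * (inverse \<zeta> ^ j * (poly p \<zeta> * \<zeta> ^ (1 - s) / (\<zeta> - z)))"
      by (simp add: x_def divide_inverse mult_ac)
    finally show "w \<zeta> * (inverse \<zeta> ^ Suc j * (poly p \<zeta> * \<zeta> ^ (1 - s) / (\<zeta> - z))) =
        w \<zeta> * (inverse z * (inverse \<zeta> ^ j * (poly p \<zeta> * \<zeta> ^ (1 - s) / (\<zeta> - z)) +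
          - 1 * (poly p \<zeta> * inverse \<zeta> ^ (j + s))))"
      by (simp add: algebra_simps)
  qed
  also have "\<dots> = inverse z * (inverse z ^ j * cauchy_transform w s p z +
      - 1 * circle_int (\<lambda>\<zeta>. w \<zeta> * (poly p \<zeta> * inverse \<zeta> ^ (j + s))))"
    unfolding circle_int_mult_left circle_int_add[OF w cont cont'] using Suc by simp
  \<comment> \<open>The exponent lies in the window \<open>s \<le> j + s < s + m\<close>, because
    \<open>Suc j \<le> m\<close>.\<close>
  also have "circle_int (\<lambda>\<zeta>. w \<zeta> * (poly p \<zeta> * inverse \<zeta> ^ (j + s))) = 0"
    using p Suc.prems by (simp add: annihilated_def)
  finally show ?case by simp
qed

text \<open>The expansion is inserted under the integral. Each \<open>inverse \<zeta> ^ j\<close>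
  may leave it as \<open>inverse z ^ j\<close>, since \<open>p (n + j)\<close> has at least
  \<open>j\<close> orthogonality relations.\<close>

lemma cauchy_transform_expansion:
  assumes w: "circle_weight w" and z: "z \<noteq> 0" "norm z \<noteq> 1" and s: "s \<le> 1"
    and p: "\<And>m. annihilated w s m (p m)"
    and P: "\<And>z. z \<noteq> 0 \<Longrightarrow> christoffel_factor K \<alpha> z * poly P z =
      (\<Sum>j\<le>K. c j * (inverse z ^ j * poly (p (n + j)) z))"
  shows "cauchy_transform (modified_weight K \<alpha> w) s P z =
    (\<Sum>j\<le>K. c j * (inverse z ^ j * cauchy_transform w s (p (n + j)) z))"
proof -
  have "cauchy_transform (modified_weight K \<alpha> w) s P z = circle_int (\<lambda>\<zeta>. w \<zeta> *
      (\<Sum>j\<le>K. c j * (inverse \<zeta> ^ j * (poly (p (n + j)) \<zeta> * \<zeta> ^ (1 - s) / (\<zeta> - z)))))"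
    unfolding cauchy_transform_def
  proof (rule circle_int_cong)
    fix \<zeta> :: complex assume "norm \<zeta> = 1"
    then have "\<zeta> \<noteq> 0" by auto
    have "modified_weight K \<alpha> w \<zeta> * (poly P \<zeta> * \<zeta> ^ (1 - s) / (\<zeta> - z)) =
        w \<zeta> * ((christoffel_factor K \<alpha> \<zeta> * poly P \<zeta>) * (\<zeta> ^ (1 - s) / (\<zeta> - z)))"
      by (simp add: modified_weight_def)
    also have "\<dots> = w \<zeta> * (\<Sum>j\<le>K. c j * (inverse \<zeta> ^ j * (poly (p (n + j)) \<zeta> * \<zeta> ^ (1 - s) / (\<zeta> - z))))"
      unfolding P[OF \<open>\<zeta> \<noteq> 0\<close>] sum_distrib_right by (simp add: mult.assoc)
    finally show "modified_weight K \<alpha> w \<zeta> * (poly P \<zeta> * \<zeta> ^ (1 - s) / (\<zeta> - z)) =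
        w \<zeta> * (\<Sum>j\<le>K. c j * (inverse \<zeta> ^ j * (poly (p (n + j)) \<zeta> * \<zeta> ^ (1 - s) / (\<zeta> - z))))" .
  qed
  also have "\<dots> = (\<Sum>j\<le>K. circle_int (\<lambda>\<zeta>. w \<zeta> *
      (c j * (inverse \<zeta> ^ j * (poly (p (n + j)) \<zeta> * \<zeta> ^ (1 - s) / (\<zeta> - z))))))"
    by (intro circle_int_sum w continuous_on_mult_left continuous_on_mult
        continuous_on_inverse_power_sphere continuous_on_cauchy_kernel[OF z(2)] continuous_intros)
  also have "\<dots> = (\<Sum>j\<le>K. c j * (inverse z ^ j * cauchy_transform w s (p (n + j)) z))"
    unfolding circle_int_mult_left
    by (intro sum.cong refl arg_cong2[where f = "(*)"] circle_int_cauchy_shift[OF w z s p]) simp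
  finally show ?thesis .
qed

section \<open>Orthogonality relations of a bi-orthogonal system\<close>

lemma biorthogonal_systemD:
  assumes "biorthogonal_system w \<phi> \<phi>b"
  shows "toeplitz_det w n \<noteq> 0" "degree (\<phi> n) = n" "degree (\<phi>b n) = n"
    "\<phi> n \<noteq> 0" "\<phi>b n \<noteq> 0"
    "circle_int (\<lambda>\<zeta>. w \<zeta> * (poly (\<phi> m) \<zeta> * poly (\<phi>b n) (1 / \<zeta>))) = (if m = n then 1 else 0)"
proof -
  show *: "circle_int (\<lambda>\<zeta>. w \<zeta> * (poly (\<phi> m) \<zeta> * poly (\<phi>b n) (1 / \<zeta>))) = (if m = n then 1 else 0)" for m n
    using assms by (simp add: biorthogonal_system_def mult.assoc)
  from *[of n n] show "\<phi> n \<noteq> 0" "\<phi>b n \<noteq> 0" by auto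
qed (use assms in \<open>auto simp: biorthogonal_system_def\<close>)

lemma continuous_on_poly_times_poly_inverse:
  "continuous_on (sphere 0 1) (\<lambda>\<zeta>. poly p \<zeta> * poly q (1 / \<zeta>))" for p q :: "complex poly"
  by (intro continuous_intros) auto

text \<open>Each integral is linear in \<open>q\<close> and vanishes on the basis formed by the
  partner polynomials of degree below \<open>m\<close>.\<close>

lemma biorthogonal_lower_degree:
  assumes w: "circle_weight w" and b: "biorthogonal_system w \<phi> \<phi>b" and q: "q = 0 \<or> degree q < m"
  shows "circle_int (\<lambda>\<zeta>. w \<zeta> * (poly (\<phi> m) \<zeta> * poly q (1 / \<zeta>))) = 0"
    and "circle_int (\<lambda>\<zeta>. w \<zeta> * (poly q \<zeta> * poly (\<phi>b m) (1 / \<zeta>))) = 0"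
proof -
  show "circle_int (\<lambda>\<zeta>. w \<zeta> * (poly (\<phi> m) \<zeta> * poly q (1 / \<zeta>))) = 0"
  proof (rule linear_functional_eq_0[where b = \<phi>b, OF _ _ _ q])
    show "circle_int (\<lambda>\<zeta>. w \<zeta> * (poly (\<phi> m) \<zeta> * poly (p + q) (1 / \<zeta>))) =
      circle_int (\<lambda>\<zeta>. w \<zeta> * (poly (\<phi> m) \<zeta> * poly p (1 / \<zeta>))) +
      circle_int (\<lambda>\<zeta>. w \<zeta> * (poly (\<phi> m) \<zeta> * poly q (1 / \<zeta>)))" for p q
      by (simp only: poly_add distrib_left
          circle_int_add[OF w continuous_on_poly_times_poly_inverse continuous_on_poly_times_poly_inverse, simplified distrib_left])
    show "circle_int (\<lambda>\<zeta>. w \<zeta> * (poly (\<phi> m) \<zeta> * poly (Polynomial.smult c p) (1 / \<zeta>))) =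
      c * circle_int (\<lambda>\<zeta>. w \<zeta> * (poly (\<phi> m) \<zeta> * poly p (1 / \<zeta>)))" for c p
      by (simp add: circle_int_mult_left[symmetric] mult.left_commute)
  qed (use biorthogonal_systemD[OF b] in auto)
  show "circle_int (\<lambda>\<zeta>. w \<zeta> * (poly q \<zeta> * poly (\<phi>b m) (1 / \<zeta>))) = 0"
  proof (rule linear_functional_eq_0[where b = \<phi>, OF _ _ _ q])
    show "circle_int (\<lambda>\<zeta>. w \<zeta> * (poly (p + q) \<zeta> * poly (\<phi>b m) (1 / \<zeta>))) =
      circle_int (\<lambda>\<zeta>. w \<zeta> * (poly p \<zeta> * poly (\<phi>b m) (1 / \<zeta>))) +
      circle_int (\<lambda>\<zeta>. w \<zeta> * (poly q \<zeta> * poly (\<phi>b m) (1 / \<zeta>)))" for p q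
      by (simp only: poly_add distrib_right
          circle_int_add[OF w continuous_on_poly_times_poly_inverse continuous_on_poly_times_poly_inverse, symmetric])
    show "circle_int (\<lambda>\<zeta>. w \<zeta> * (poly (Polynomial.smult c p) \<zeta> * poly (\<phi>b m) (1 / \<zeta>))) =
      c * circle_int (\<lambda>\<zeta>. w \<zeta> * (poly p \<zeta> * poly (\<phi>b m) (1 / \<zeta>)))" for c p
      by (simp add: circle_int_mult_left[symmetric] mult.assoc)
  qed (use biorthogonal_systemD[OF b] in auto)
qed

lemma annihilated_biorthogonal:
  assumes "circle_weight w" "biorthogonal_system w \<phi> \<phi>b"
  shows "annihilated w 0 m (\<phi> m)"
  unfolding annihilated_def
proof (intro allI impI)
  fix k assume "0 \<le> k \<and> k < 0 + m"
  then show "circle_int (\<lambda>\<zeta>. w \<zeta> * (poly (\<phi> m) \<zeta> * inverse \<zeta> ^ k)) = 0"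
    using biorthogonal_lower_degree(1)[OF assms, of "monom 1 k" m]
    by (simp add: poly_monom degree_monom_eq inverse_eq_divide)
qed

lemma poly_reciprocal_seq:
  assumes "biorthogonal_system w \<phi> \<phi>b" "\<zeta> \<noteq> 0"
  shows "poly (reciprocal_seq \<phi>b m) \<zeta> = \<zeta> ^ m * poly (\<phi>b m) (1 / \<zeta>)"
  using poly_reflect_poly_nz[OF assms(2), of "\<phi>b m"] biorthogonal_systemD(3)[OF assms(1)]
  by (simp add: reciprocal_seq_def inverse_eq_divide)

text \<open>The integrand contains \<open>\<zeta>^(m-k)\<close> times \<open>\<phi>b m\<close> at
  \<open>1/\<zeta>\<close>, and \<open>0 \<le> m - k < m\<close> holds exactly for
  \<open>1 \<le> k \<le> m\<close>; hence the offset 1.\<close>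

lemma annihilated_reciprocal_seq:
  assumes "circle_weight w" "biorthogonal_system w \<phi> \<phi>b"
  shows "annihilated w 1 m (reciprocal_seq \<phi>b m)"
  unfolding annihilated_def
proof (intro allI impI)
  fix k assume k: "1 \<le> k \<and> k < 1 + m"
  have "circle_int (\<lambda>\<zeta>. w \<zeta> * (poly (reciprocal_seq \<phi>b m) \<zeta> * inverse \<zeta> ^ k)) =
      circle_int (\<lambda>\<zeta>. w \<zeta> * (poly (monom 1 (m - k)) \<zeta> * poly (\<phi>b m) (1 / \<zeta>)))"
  proof (rule circle_int_cong)
    fix \<zeta> :: complex assume "norm \<zeta> = 1"
    then have "\<zeta> \<noteq> 0" by auto
    then show "w \<zeta> * (poly (reciprocal_seq \<phi>b m) \<zeta> * inverse \<zeta> ^ k) =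
        w \<zeta> * (poly (monom 1 (m - k)) \<zeta> * poly (\<phi>b m) (1 / \<zeta>))"
      using k by (simp add: poly_reciprocal_seq[OF assms(2)] poly_monom power_diff power_inverse field_simps)
  qed
  also have "\<dots> = 0"
    using k by (intro biorthogonal_lower_degree(2)[OF assms]) (auto simp: degree_monom_eq)
  finally show "circle_int (\<lambda>\<zeta>. w \<zeta> * (poly (reciprocal_seq \<phi>b m) \<zeta> * inverse \<zeta> ^ k)) = 0" .
qed

section \<open>Associated functions as Cauchy transforms\<close>

text \<open>Both the special values at \<open>n = 0\<close> and the integrals at \<open>n > 0\<close> amount to replacing the
  kernel \<open>(\<zeta> + z) / (\<zeta> - z)\<close> by \<open>1 + (\<zeta> + z) / (\<zeta> - z) = 2 \<zeta> / (\<zeta> - z)\<close>.\<close>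

lemma assoc_eq_cauchy_transform:
  assumes w: "circle_weight w" and b: "biorthogonal_system w \<phi> \<phi>b" and z: "norm z \<noteq> 1"
  shows "assoc w \<phi> n z = 2 * cauchy_transform w 0 (\<phi> n) z"
proof -
  let ?g = "\<lambda>\<zeta>. poly (\<phi> n) \<zeta> * (\<zeta> + z) / (\<zeta> - z)"
  \<comment> \<open>The first integral is the term with \<open>moment w 0\<close> if
    \<open>n = 0\<close>, and zero by orthogonality to 1 otherwise.\<close>
  have "assoc w \<phi> n z = circle_int (\<lambda>\<zeta>. w \<zeta> * poly (\<phi> n) \<zeta>) + circle_int (\<lambda>\<zeta>. w \<zeta> * ?g \<zeta>)"
  proof (cases "n = 0")
    case True
    obtain \<kappa> where \<kappa>: "\<phi> 0 = [:\<kappa>:]"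
      using biorthogonal_systemD(2)[OF b, of 0] by (metis degree_eq_zeroE)
    have "moment w 0 = circle_int (\<lambda>\<zeta>. w \<zeta> * 1)"
      "carath w z = circle_int (\<lambda>\<zeta>. w \<zeta> * ((\<zeta> + z) / (\<zeta> - z)))"
      by (simp_all add: moment_def carath_def mult.commute)
    then have "assoc w \<phi> n z = circle_int (\<lambda>\<zeta>. w \<zeta> * (\<kappa> * 1)) +
        circle_int (\<lambda>\<zeta>. w \<zeta> * (\<kappa> * ((\<zeta> + z) / (\<zeta> - z))))"
      unfolding circle_int_mult_left by (simp add: True assoc_def \<kappa> distrib_left)
    then show ?thesis by (simp add: True \<kappa>)
  next
    case False
    then have "circle_int (\<lambda>\<zeta>. w \<zeta> * poly (\<phi> n) \<zeta>) = 0"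
      using annihilated_biorthogonal[OF w b, of n] by (auto simp: annihilated_def dest!: spec[of _ 0])
    with False show ?thesis by (simp add: assoc_def mult.commute mult.left_commute)
  qed
  also have "\<dots> = circle_int (\<lambda>\<zeta>. w \<zeta> * (poly (\<phi> n) \<zeta> + ?g \<zeta>))"
    by (intro circle_int_add[symmetric] w continuous_on_cauchy_kernel z continuous_intros)
  also have "\<dots> = circle_int (\<lambda>\<zeta>. w \<zeta> * (2 * (poly (\<phi> n) \<zeta> * \<zeta> ^ (1 - 0) / (\<zeta> - z))))"
  proof (rule circle_int_cong)
    fix \<zeta> :: complex assume "norm \<zeta> = 1"
    with z have "\<zeta> - z \<noteq> 0" by auto
    then show "w \<zeta> * (poly (\<phi> n) \<zeta> + ?g \<zeta>) = w \<zeta> * (2 * (poly (\<phi> n) \<zeta> * \<zeta> ^ (1 - 0) / (\<zeta> - z)))"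
      by (simp add: field_simps)
  qed
  also have "\<dots> = 2 * cauchy_transform w 0 (\<phi> n) z"
    by (simp only: circle_int_mult_left cauchy_transform_def)
  finally show ?thesis .
qed

text \<open>For \<open>n = 0\<close> the kernel is
  \<open>1 - (\<zeta> + z) / (\<zeta> - z) = - 2 z / (\<zeta> - z)\<close>. For
  \<open>n > 0\<close>, replacing \<open>z^n\<close> by \<open>\<zeta>^n\<close> in the numerator
  changes the kernel by a polynomial in \<open>\<zeta>\<close> of degree below \<open>n\<close>,
  which is orthogonal to \<open>\<phi>b n\<close> at \<open>1/\<zeta>\<close>.\<close>

lemma assoc_star_eq_cauchy_transform:
  assumes w: "circle_weight w" and b: "biorthogonal_system w \<phi> \<phi>b" and z: "norm z \<noteq> 1"
  shows "assoc_star w \<phi>b n z = - 2 * z * cauchy_transform w 1 (reciprocal_seq \<phi>b n) z"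
proof (cases "n = 0")
  case True
  obtain \<kappa> where \<kappa>: "\<phi>b 0 = [:\<kappa>:]"
    using biorthogonal_systemD(3)[OF b, of 0] by (metis degree_eq_zeroE)
  have \<kappa>': "reciprocal_seq \<phi>b 0 = [:\<kappa>:]"
    by (simp add: reciprocal_seq_def \<kappa>)
  have "moment w 0 = circle_int (\<lambda>\<zeta>. w \<zeta> * 1)"
    "carath w z = circle_int (\<lambda>\<zeta>. w \<zeta> * ((\<zeta> + z) / (\<zeta> - z)))"
    by (simp_all add: moment_def carath_def mult.commute)
  then have "assoc_star w \<phi>b n z = circle_int (\<lambda>\<zeta>. w \<zeta> * (\<kappa> * 1)) +
      circle_int (\<lambda>\<zeta>. w \<zeta> * ((- \<kappa>) * ((\<zeta> + z) / (\<zeta> - z))))"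
    unfolding circle_int_mult_left by (simp add: True assoc_star_def \<kappa> right_diff_distrib)
  also have "\<dots> =
      circle_int (\<lambda>\<zeta>. w \<zeta> * \<kappa>) + circle_int (\<lambda>\<zeta>. w \<zeta> * ((- \<kappa>) * (\<zeta> + z) / (\<zeta> - z)))"
    by simp
  also have "\<dots> = circle_int (\<lambda>\<zeta>. w \<zeta> * (\<kappa> + (- \<kappa>) * (\<zeta> + z) / (\<zeta> - z)))"
    by (intro circle_int_add[symmetric] w continuous_on_cauchy_kernel z continuous_intros)
  also have "\<dots> = circle_int (\<lambda>\<zeta>. w \<zeta> * ((- 2 * z) * (poly (reciprocal_seq \<phi>b 0) \<zeta> * \<zeta> ^ (1 - 1) / (\<zeta> - z))))"
  proof (rule circle_int_cong)
    fix \<zeta> :: complex assume "norm \<zeta> = 1"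
    with z have "\<zeta> - z \<noteq> 0" by auto
    then show "w \<zeta> * (\<kappa> + (- \<kappa>) * (\<zeta> + z) / (\<zeta> - z)) =
        w \<zeta> * ((- 2 * z) * (poly (reciprocal_seq \<phi>b 0) \<zeta> * \<zeta> ^ (1 - 1) / (\<zeta> - z)))"
      by (simp add: \<kappa>' field_simps)
  qed
  also have "\<dots> = - 2 * z * cauchy_transform w 1 (reciprocal_seq \<phi>b n) z"
    by (simp only: circle_int_mult_left cauchy_transform_def True)
  finally show ?thesis .
next
  case False
  text \<open>The polynomial \<open>q\<close> is \<open>2 z (\<zeta>\<^sup>n - z\<^sup>n) / (\<zeta> - z) - z\<^sup>n\<close>.\<close>
  define q where "q = Polynomial.smult (2 * z) (\<Sum>i<n. monom (z ^ (n - Suc i)) i) - [:z ^ n:]"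
  have "degree (\<Sum>i<n. monom (z ^ (n - Suc i)) i) \<le> n - 1"
    by (intro degree_sum_le) (auto intro!: order_trans[OF degree_monom_le])
  then have "degree q \<le> n - 1"
    unfolding q_def by (intro degree_diff_le order_trans[OF degree_smult_le]) auto
  then have orth: "circle_int (\<lambda>\<zeta>. w \<zeta> * (poly q \<zeta> * poly (\<phi>b n) (1 / \<zeta>))) = 0"
    using False by (intro biorthogonal_lower_degree(2)[OF w b]) auto
  let ?g = "\<lambda>\<zeta>. (- 2 * z) * (poly (reciprocal_seq \<phi>b n) \<zeta> * \<zeta> ^ (1 - 1) / (\<zeta> - z))"
  have "assoc_star w \<phi>b n z =
      circle_int (\<lambda>\<zeta>. w \<zeta> * (- (z ^ n) * ((\<zeta> + z) / (\<zeta> - z) * poly (\<phi>b n) (1 / \<zeta>))))"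
    using False unfolding assoc_star_def circle_int_mult_left by (simp add: mult_ac)
  also have "\<dots> = circle_int (\<lambda>\<zeta>. w \<zeta> * (?g \<zeta> + poly q \<zeta> * poly (\<phi>b n) (1 / \<zeta>)))"
  proof (rule circle_int_cong)
    fix \<zeta> :: complex assume "norm \<zeta> = 1"
    with z have \<zeta>: "\<zeta> \<noteq> 0" "\<zeta> - z \<noteq> 0" by auto
    define b where "b = poly (\<phi>b n) (1 / \<zeta>)"
    have "\<zeta> ^ n - z ^ n = (\<zeta> - z) * (\<Sum>i<n. z ^ (n - Suc i) * \<zeta> ^ i)"
      by (rule power_diff_sumr2)
    then have q: "poly q \<zeta> = 2 * z * ((\<zeta> ^ n - z ^ n) / (\<zeta> - z)) - z ^ n"
      using \<zeta>(2) by (simp add: q_def poly_sum poly_monom)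
    \<comment> \<open>Used with \<open>d = \<zeta> - z\<close>, so that \<open>d + 2 * z\<close> is
      \<open>\<zeta> + z\<close>.\<close>
    have "(- 2 * z) * (x * b / d) + (2 * z * ((x - y) / d) - y) * b = - y * ((d + 2 * z) / d * b)"
      if "d \<noteq> 0" for d x y
      using that by (simp add: field_simps)
    from this[OF \<zeta>(2), of "\<zeta> ^ n" "z ^ n"]
    have "?g \<zeta> + poly q \<zeta> * b = - (z ^ n) * ((\<zeta> + z) / (\<zeta> - z) * b)"
      by (simp add: q poly_reciprocal_seq[OF \<open>biorthogonal_system w \<phi> \<phi>b\<close> \<zeta>(1)] b_def[symmetric])
    then show "w \<zeta> * (- (z ^ n) * ((\<zeta> + z) / (\<zeta> - z) * poly (\<phi>b n) (1 / \<zeta>))) =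
        w \<zeta> * (?g \<zeta> + poly q \<zeta> * poly (\<phi>b n) (1 / \<zeta>))"
      by (simp add: b_def)
  qed
  also have "\<dots> = circle_int (\<lambda>\<zeta>. w \<zeta> * ?g \<zeta>) + circle_int (\<lambda>\<zeta>. w \<zeta> * (poly q \<zeta> * poly (\<phi>b n) (1 / \<zeta>)))"
    by (intro circle_int_add w continuous_on_poly_times_poly_inverse continuous_on_mult_left
        continuous_on_cauchy_kernel z continuous_intros)
  also have "\<dots> = - 2 * z * cauchy_transform w 1 (reciprocal_seq \<phi>b n) z"
    by (simp only: orth circle_int_mult_left cauchy_transform_def add_0_right)
  finally show ?thesis .
qed

theorem proposition3p4:
  fixes w :: "complex \<Rightarrow> complex"
    and \<phi> \<phi>b \<Phi> \<Phi>b :: "nat \<Rightarrow> complex poly"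
    and K n :: nat
    and \<alpha> :: "nat \<Rightarrow> complex"
  assumes "circle_weight w"
    and "K \<ge> 1"
    and "inj_on \<alpha> {1..K}"
    and "\<And>j. j \<in> {1..K} \<Longrightarrow> \<alpha> j \<noteq> 0"
    and "biorthogonal_system w \<phi> \<phi>b"
    and "generic_system \<phi> \<phi>b"
    and "biorthogonal_system (modified_weight K \<alpha> w) \<Phi> \<Phi>b"
    and "generic_system \<Phi> \<Phi>b"
  shows "\<exists>C Cs :: complex.
    (\<forall>z. z \<noteq> 0 \<longrightarrow>
       christoffel_factor K \<alpha> z * poly (\<Phi> n) z =
         C * christoffel_det K \<alpha> n (\<lambda>m. poly (\<phi> m)) (\<lambda>m. poly (\<phi> m)) z \<and>
       christoffel_factor K \<alpha> z * poly (reciprocal_seq \<Phi>b n) z =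
         Cs * christoffel_det K \<alpha> n (\<lambda>m. poly (reciprocal_seq \<phi>b m))
                (\<lambda>m. poly (reciprocal_seq \<phi>b m)) z) \<and>
    (\<forall>z. z \<noteq> 0 \<and> norm z \<noteq> 1 \<longrightarrow>
       assoc (modified_weight K \<alpha> w) \<Phi> n z =
         C * christoffel_det K \<alpha> n (assoc w \<phi>) (\<lambda>m. poly (\<phi> m)) z \<and>
       assoc_star (modified_weight K \<alpha> w) \<Phi>b n z =
         Cs * christoffel_det K \<alpha> n (assoc_star w \<phi>b) (\<lambda>m. poly (reciprocal_seq \<phi>b m)) z)"
proof -
  note w = \<open>circle_weight w\<close>
  note b = \<open>biorthogonal_system w \<phi> \<phi>b\<close>
  let ?w = "modified_weight K \<alpha> w"
  note B = \<open>biorthogonal_system ?w \<Phi> \<Phi>b\<close>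
  note w' = circle_weight_modified[OF w, of K \<alpha>]
  let ?\<phi>s = "reciprocal_seq \<phi>b" and ?\<Phi>s = "reciprocal_seq \<Phi>b"
  note bD = biorthogonal_systemD[OF b] and BD = biorthogonal_systemD[OF B]
  \<comment> \<open>For \<open>m \<ge> 1\<close> this is genericity of the reflection coefficients;
    \<open>\<phi> 0\<close> is a nonzero constant.\<close>
  have \<phi>0: "coeff (\<phi> m) 0 \<noteq> 0" for m
  proof (cases "m = 0")
    case True
    then show ?thesis using bD(2)[of 0] bD(4)[of 0] by (metis leading_coeff_0_iff)
  next
    case False
    then have "refl_coeff \<phi> m * refl_coeff \<phi>b m \<noteq> 0"
      using \<open>generic_system \<phi> \<phi>b\<close> by (simp add: generic_system_def)
    then show ?thesis by (auto simp: refl_coeff_def poly_0_coeff_0)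
  qed
  have star: "degree (?\<phi>s m) \<le> m" "degree (?\<Phi>s m) \<le> m" for m
    using degree_reflect_poly_le[of "\<phi>b m"] degree_reflect_poly_le[of "\<Phi>b m"]
    by (simp_all add: reciprocal_seq_def bD(3) BD(3))
  \<comment> \<open>The constant term of a reciprocal polynomial is the leading coefficient of the
    original.\<close>
  have star0: "coeff (?\<phi>s m) 0 \<noteq> 0" "coeff (?\<Phi>s m) 0 \<noteq> 0" for m
    using bD(5) BD(5) by (simp_all add: reciprocal_seq_def)
  \<comment> \<open>The indices are kept in the form \<open>(1 - s) * n\<close> of
    \<open>christoffel_expansion\<close>.\<close>
  have low: "coeff (?\<phi>s n) ((1 - 1) * n) \<noteq> 0" "coeff (?\<Phi>s n) ((1 - 1) * n) \<noteq> 0"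
    using star0 by simp_all
  have lead: "coeff (\<phi> n) ((1 - 0) * n) \<noteq> 0" "coeff (\<Phi> n) ((1 - 0) * n) \<noteq> 0"
    using bD(2,4)[of n] BD(2,4)[of n] by (metis leading_coeff_0_iff diff_zero mult_1)+
  \<comment> \<open>Here \<open>s = 0\<close>; the reciprocal family below uses
    \<open>s = 1\<close>.\<close>
  obtain C c where
    "\<forall>z. z \<noteq> 0 \<longrightarrow> christoffel_factor K \<alpha> z * poly (\<Phi> n) z =
      (\<Sum>j\<le>K. c j * (inverse z ^ j * poly (\<phi> (n + j)) z))"
    "\<forall>a z. (\<Sum>j\<le>K. c j * (inverse z ^ j * a (n + j) z)) =
      C * christoffel_det K \<alpha> n a (\<lambda>m. poly (\<phi> m)) z"
    using christoffel_expansion[OF w le0 assms(3,4) bD(1) BD(1)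
        annihilated_biorthogonal[OF w b] eq_refl[OF bD(2)] \<phi>0 lead(1)
        annihilated_biorthogonal[OF w' B] eq_refl[OF BD(2)] lead(2)]
    by blast
  note c = this(1)[rule_format] and C = this(2)[rule_format]
  obtain Cs cs where
    "\<forall>z. z \<noteq> 0 \<longrightarrow> christoffel_factor K \<alpha> z * poly (?\<Phi>s n) z =
      (\<Sum>j\<le>K. cs j * (inverse z ^ j * poly (?\<phi>s (n + j)) z))"
    "\<forall>a z. (\<Sum>j\<le>K. cs j * (inverse z ^ j * a (n + j) z)) =
      Cs * christoffel_det K \<alpha> n a (\<lambda>m. poly (?\<phi>s m)) z"
    using christoffel_expansion[OF w order_refl assms(3,4) bD(1) BD(1)
        annihilated_reciprocal_seq[OF w b] star(1) star0(1) low(1)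
        annihilated_reciprocal_seq[OF w' B] star(2) low(2)]
    by blast
  note cs = this(1)[rule_format] and Cs = this(2)[rule_format]
  show ?thesis
  proof (intro exI conjI allI impI)
    fix z :: complex assume z: "z \<noteq> 0"
    show "christoffel_factor K \<alpha> z * poly (\<Phi> n) z =
        C * christoffel_det K \<alpha> n (\<lambda>m. poly (\<phi> m)) (\<lambda>m. poly (\<phi> m)) z"
      unfolding c[OF z] by (rule C)
    show "christoffel_factor K \<alpha> z * poly (?\<Phi>s n) z =
        Cs * christoffel_det K \<alpha> n (\<lambda>m. poly (?\<phi>s m)) (\<lambda>m. poly (?\<phi>s m)) z"
      unfolding cs[OF z] by (rule Cs)
  next
    fix z :: complex assume "z \<noteq> 0 \<and> norm z \<noteq> 1"
    then have z: "z \<noteq> 0" "norm z \<noteq> 1" by auto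
    have "cauchy_transform ?w 0 (\<Phi> n) z =
        (\<Sum>j\<le>K. c j * (inverse z ^ j * cauchy_transform w 0 (\<phi> (n + j)) z))"
      by (rule cauchy_transform_expansion[OF w z le0 annihilated_biorthogonal[OF w b] c])
    then have "assoc ?w \<Phi> n z = (\<Sum>j\<le>K. c j * (inverse z ^ j * assoc w \<phi> (n + j) z))"
      unfolding assoc_eq_cauchy_transform[OF w b z(2)] assoc_eq_cauchy_transform[OF w' B z(2)]
      by (simp add: sum_distrib_left mult_ac)
    also have "\<dots> = C * christoffel_det K \<alpha> n (assoc w \<phi>) (\<lambda>m. poly (\<phi> m)) z"
      by (rule C)
    finally show "assoc ?w \<Phi> n z = C * christoffel_det K \<alpha> n (assoc w \<phi>) (\<lambda>m. poly (\<phi> m)) z" .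
    have "cauchy_transform ?w 1 (?\<Phi>s n) z =
        (\<Sum>j\<le>K. cs j * (inverse z ^ j * cauchy_transform w 1 (?\<phi>s (n + j)) z))"
      by (rule cauchy_transform_expansion[OF w z order_refl annihilated_reciprocal_seq[OF w b] cs])
    \<comment> \<open>The prefactor \<open>- 2 * z\<close> is common to all terms, so the
      coefficients \<open>cs\<close> stay the same.\<close>
    then have "assoc_star ?w \<Phi>b n z = (\<Sum>j\<le>K. cs j * (inverse z ^ j * assoc_star w \<phi>b (n + j) z))"
      unfolding assoc_star_eq_cauchy_transform[OF w b z(2)] assoc_star_eq_cauchy_transform[OF w' B z(2)]
      by (simp add: sum_distrib_left mult_ac)
    also have "\<dots> = Cs * christoffel_det K \<alpha> n (assoc_star w \<phi>b) (\<lambda>m. poly (?\<phi>s m)) z"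
      by (rule Cs)
    finally show "assoc_star ?w \<Phi>b n z =
        Cs * christoffel_det K \<alpha> n (assoc_star w \<phi>b) (\<lambda>m. poly (?\<phi>s m)) z" .
  qed
qed

end
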